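(* Let $d:\mathbb{R}\to\mathbb{R}$ be an additive function, let $I\subseteq\mathbb{R}$ be a nonempty open interval not containing zero, and assume that $P,Q:I\to\mathbb{R}$ are of the form $$P(u)=\sum_{k\in\mathbb{Z}}p_ku^k,\qquad Q(u)=\sum_{k\in\mathbb{Z}}q_ku^k,$$ where $p_k,q_k\in\mathbb{Q}$ for all $k\in\mathbb{Z}$ and the set $\{k\in\mathbb{Z}\mid(p_k,q_k)\neq(0,0)\}$ is finite. Assume that $Q'$ is non-vanishing on $I$, that $P-p_0$ and $Q-q_0$ are linearly independent, and that $d$ derivates $P\circ Q^{-1}$ on $J:=Q(I)$. Then $d$ is a standard derivation.
   Context: A function $d:\mathbb{R}\to\mathbb{R}$ is additive if $d(x+y)=d(x)+d(y)$ for all $x,y\in\mathbb{R}$. It is a standard derivation if it is additive and satisfies $d(xy)=d(x)y+x\,d(y)$ for all $x,y\in\mathbb{R}$. A function $d$ derivates a differentiable function $f:J\to\mathbb{R}$ on the open interval $J$ if $d(f(x))=f'(x)\,d(x)$ for all $x\in J$. Linear independence is that of real-valued functions on $I$, over $\mathbb{R}$; $p_0$ and $q_0$ are the coefficients of $u^0$ in $P$ and $Q$. $Q^{-1}:J\to I$ denotes the inverse function of $Q$ (which exists since $Q'$ does not vanish on the interval $I$). *)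

theory Defs
  imports "HOL-Analysis.Analysis"
begin

(* Additivity is the locale predicate Modules.additive; the unqualified name is
   hidden by the measure-theoretic notion from Measure_Space. *)
definition standard_derivation :: "(real \<Rightarrow> real) \<Rightarrow> bool" where
  "standard_derivation d \<longleftrightarrow>
     Modules.additive d \<and> (\<forall>x y. d (x * y) = d x * y + x * d y)"

(* Meant for open J: the derivative at x \<in> J then depends only on f restricted to J. *)
definition derivates_on :: "(real \<Rightarrow> real) \<Rightarrow> (real \<Rightarrow> real) \<Rightarrow> real set \<Rightarrow> bool" where
  "derivates_on d f J \<longleftrightarrow>
     (\<forall>x\<in>J. f field_differentiable (at x)) \<and> (\<forall>x\<in>J. d (f x) = deriv f x * d x)"

definition lin_indep_on :: "real set \<Rightarrow> (real \<Rightarrow> real) \<Rightarrow> (real \<Rightarrow> real) \<Rightarrow> bool" where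
  "lin_indep_on I f g \<longleftrightarrow>
     (\<forall>a b. (\<forall>u\<in>I. a * f u + b * g u = 0) \<longrightarrow> a = 0 \<and> b = 0)"

end

theory Submission
  imports Defs
begin

text \<open>
  Writing \<open>P = (P \<circ> Q\<^sup>-\<^sup>1) \<circ> Q\<close>, the chain rule turns the hypothesis on \<open>d\<close> into
  \<open>Q' u * d (P u) = P' u * d (Q u)\<close> for \<open>u \<in> I\<close> (lemma \<open>derivates_chain\<close>). Expanding both Laurent
  polynomials and multiplying by \<open>u\<close> gives
  \<open>\<Sum>k l. c(k,l) * l * u^l * d(u^k) = 0\<close> with the minors \<open>c(k,l) = p k * q l - q k * p l\<close>.
  Since \<open>d\<close> is linear over the rationals, replacing \<open>u\<close> by \<open>r u\<close> with \<open>r\<close> rational multiplies the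
  summand by \<open>r^(k+l)\<close>, and \<open>r u\<close> lies in \<open>I\<close> for infinitely many rational \<open>r\<close>, whatever
  \<open>u \<noteq> 0\<close> is. So the part of the sum with \<open>k + l = n\<close> vanishes for each \<open>n\<close>, and the identity
  spreads from \<open>I\<close> to all \<open>u \<noteq> 0\<close>.

  A single \<open>n\<close> could contribute many pairs, and then the relation could be too weak: a composite
  of derivations can satisfy such a relation. The key point is that for the largest \<open>n\<close> with a
  nonzero minor \<open>c(k,l)\<close>, \<open>k + l = n\<close>, the pair \<open>{k, l}\<close> is unique
  (lemma \<open>extremal_minor_unique\<close>). By antisymmetry of \<open>c\<close> the relation becomes
  \<open>l u^l d(u^k) = k u^k d(u^l)\<close> for this one pair.
  This is used twice. At \<open>u = 1\<close>, over all exponents, it reads \<open>l * d 1 = k * d 1\<close> with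
  \<open>k \<noteq> l\<close>, so \<open>d 1 = 0\<close>. Then the terms with \<open>k = 0\<close> or \<open>l = 0\<close> drop out, and over the nonzero
  exponents, where linear independence still provides a nonzero minor, one gets the relation with
  distinct nonzero \<open>k\<close> and \<open>l\<close>.

  That single relation forces \<open>d(u^2) = 2 u d(u)\<close>, and polarization gives the product rule. For
  positive \<open>k, l\<close> one compares the coefficients of \<open>r^2\<close> after substituting \<open>1 + r u\<close>. In
  general, iterating the relation replaces \<open>(k, l)\<close> by \<open>(k^2, l^2)\<close>, which are positive and
  distinct unless \<open>k = -l\<close>; in that case extracting \<open>l\<close>-th roots yields
  \<open>d(1/v) = - d(v) / v^2\<close>, and one concludes with the partial fraction
  \<open>1/u - 1/(u+1) = 1/(u^2+u)\<close>.
\<close>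

section \<open>Rational linearity and Laurent polynomials\<close>

lemma additive_of_nat_scale:
  fixes d :: "real \<Rightarrow> real"
  assumes "Modules.additive d"
  shows "d (of_nat n * x) = of_nat n * d x"
proof -
  interpret Modules.additive d by fact
  show ?thesis by (induction n) (simp_all add: algebra_simps zero add)
qed

lemma additive_Rats_scale:
  fixes d :: "real \<Rightarrow> real"
  assumes "Modules.additive d" "r \<in> \<rat>"
  shows "d (r * x) = r * d x"
proof -
  interpret Modules.additive d by fact
  obtain m n where n: "n > 0" and r: "r = of_int m / of_nat n"
    using \<open>r \<in> \<rat>\<close> by (rule Rats_cases') (metis of_int_of_nat_eq zero_less_imp_eq_int)
  have int: "d (of_int m * y) = of_int m * d y" for m y
    by (cases m rule: int_cases2)
       (simp_all add: additive_of_nat_scale[OF assms(1)] minus)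
  have "of_nat n * d (r * x) = d (of_nat n * (r * x))"
    by (rule additive_of_nat_scale[OF assms(1), symmetric])
  also have "\<dots> = d (of_int m * x)" using n by (simp add: r)
  also have "\<dots> = of_int m * d x" by (rule int)
  finally show ?thesis using n by (simp add: r field_simps)
qed

text \<open>
  After multiplication by a power of \<open>r\<close> the sum is a polynomial in \<open>r\<close> with infinitely many roots.
\<close>

lemma laurent_coeff_eq_0:
  fixes a :: "int \<Rightarrow> 'a :: field"
  assumes "finite S" "infinite A" "0 \<notin> A"
    and zero: "\<And>r. r \<in> A \<Longrightarrow> (\<Sum>k\<in>S. a k * r powi k) = 0"
    and "n \<in> S"
  shows "a n = 0"
proof -
  define m where "m = Min S"
  have m: "m \<le> k" if "k \<in> S" for k using that assms(1) by (simp add: m_def)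
  define f where "f = (\<Sum>k\<in>S. monom (a k) (nat (k - m)))"
  have "poly f r = 0" if r: "r \<in> A" for r
  proof -
    have r0: "r \<noteq> 0" using r assms(3) by auto
    have "poly f r = (\<Sum>k\<in>S. a k * r powi (k - m))"
      unfolding f_def poly_sum poly_monom
      by (intro sum.cong refl) (use m in \<open>simp add: power_int_def\<close>)
    also have "\<dots> = (\<Sum>k\<in>S. a k * r powi k) / r powi m"
      unfolding sum_divide_distrib by (intro sum.cong refl) (simp add: power_int_diff r0)
    finally show ?thesis using zero[OF r] by simp
  qed
  hence "A \<subseteq> {r. poly f r = 0}" by auto
  hence "f = 0" using \<open>infinite A\<close> poly_roots_finite finite_subset by blast
  hence "0 = coeff f (nat (n - m))" by simp
  also have "\<dots> = (\<Sum>k\<in>S. if k = n then a k else 0)"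
    unfolding f_def coeff_sum coeff_monom
    by (intro sum.cong refl) (use m \<open>n \<in> S\<close> in \<open>auto simp: nat_eq_iff2\<close>)
  also have "\<dots> = a n" using assms by simp
  finally show ?thesis by simp
qed

lemma DERIV_laurent:
  fixes p :: "int \<Rightarrow> real"
  assumes "u \<noteq> 0"
  shows "((\<lambda>u. \<Sum>k\<in>S. p k * u powi k) has_real_derivative
           (\<Sum>k\<in>S. of_int k * p k * u powi k) / u) (at u)"
proof -
  have "((\<lambda>u. \<Sum>k\<in>S. p k * u powi k) has_real_derivative
           (\<Sum>k\<in>S. p k * (of_int k * u powi (k - 1)))) (at u)"
    by (intro DERIV_sum DERIV_cmult) (use assms in \<open>auto intro!: derivative_eq_intros\<close>)
  also have "(\<Sum>k\<in>S. p k * (of_int k * u powi (k - 1))) = (\<Sum>k\<in>S. of_int k * p k * u powi k) / u"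
    unfolding sum_divide_distrib
    by (intro sum.cong refl) (use assms in \<open>simp add: power_int_diff\<close>)
  finally show ?thesis .
qed

text \<open>
  The admissible factors form a nonempty open set, in which the rationals are dense. If there were
  only finitely many rational ones, then some right neighbourhood of a point \<open>x\<close> of
  this set would contain a smallest rational, but a smaller one lies between it and \<open>x\<close>.
\<close>

lemma infinite_rational_dilations:
  fixes I :: "real set"
  assumes "open I" "I \<noteq> {}" "u \<noteq> 0"
  shows "infinite {r \<in> \<rat>. r * u \<in> I}"
proof -
  define x where "x = (SOME v. v \<in> I) / u"
  have "x \<in> (\<lambda>r. r * u) -` I" using assms by (simp add: x_def some_in_eq)
  moreover have "open ((\<lambda>r. r * u) -` I)"
    by (rule open_vimage[OF \<open>open I\<close>]) (intro continuous_intros)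
  ultimately obtain e where "e > 0" and "ball x e \<subseteq> (\<lambda>r. r * u) -` I"
    using open_contains_ball by metis
  hence e: "r * u \<in> I" if "x < r" "r < x + e" for r
    using that by (auto simp: subset_iff dist_real_def)
  define B where "B = {r \<in> \<rat>. r * u \<in> I}"
  have smaller: "\<exists>s\<in>B. x < s \<and> s < r" if "x < r" "r \<le> x + e" for r
    using Rats_dense_in_real[OF \<open>x < r\<close>] e that by (force simp: B_def)
  have "infinite B"
  proof
    assume "finite B"
    define C where "C = B \<inter> {x<..<x + e}"
    have C: "finite C" "C \<noteq> {}"
      using \<open>finite B\<close> smaller[of "x + e"] \<open>e > 0\<close> by (auto simp: C_def)
    hence "Min C \<in> C" by (rule Min_in)
    then obtain s where "s \<in> C" "s < Min C"
      using smaller[of "Min C"] by (force simp: C_def)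
    thus False using Min_le[OF C(1)] by force
  qed
  thus ?thesis by (simp add: B_def)
qed

section \<open>Minors of a pair of coefficient sequences\<close>

definition minor :: "(int \<Rightarrow> 'a :: comm_ring) \<Rightarrow> (int \<Rightarrow> 'a) \<Rightarrow> int \<Rightarrow> int \<Rightarrow> 'a" where
  "minor p q k l = p k * q l - q k * p l"

lemma minor_swap: "minor p q l k = - minor p q k l"
  by (simp add: minor_def mult.commute)

lemma minor_diag [simp]: "minor p q k k = 0"
  by (simp add: minor_def mult.commute)

text \<open>
  The \<open>i\<close>-th column \<open>(p i, q i)\<close> is nonzero, and the columns \<open>k\<close> and \<open>l\<close> are both parallel to it.
\<close>

lemma minor_proportional:
  fixes p q :: "int \<Rightarrow> 'a :: idom"
  assumes "minor p q i k = 0" "minor p q i l = 0" "minor p q i j \<noteq> 0"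
  shows "minor p q k l = 0"
proof (cases "p i = 0")
  case True
  hence "q i \<noteq> 0" using assms(3) by (auto simp: minor_def)
  thus ?thesis using assms(1,2) True by (simp add: minor_def)
next
  case False
  have "p i * minor p q k l = p k * minor p q i l - p l * minor p q i k"
    by (simp add: minor_def algebra_simps)
  thus ?thesis using assms(1,2) False by simp
qed

text \<open>
  The pair carrying the nonzero minor of largest weight \<open>k + l\<close> is unique. If a second such pair
  \<open>i, j\<close> had \<open>i\<close> beyond both \<open>k\<close> and \<open>l\<close>, then \<open>i + k\<close> and \<open>i + l\<close> would exceed the maximal weight,
  so the columns \<open>k\<close> and \<open>l\<close> would be parallel to the nonzero column \<open>i\<close> and hence to each other.
  By symmetry the two pairs have the same maximum, and they have the same sum.
\<close>

lemma extremal_minor_unique: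
  fixes p q :: "int \<Rightarrow> 'a :: idom"
  assumes max: "\<And>i j. i \<in> T \<Longrightarrow> j \<in> T \<Longrightarrow> minor p q i j \<noteq> 0 \<Longrightarrow> i + j \<le> n"
    and kl: "k \<in> T" "l \<in> T" "k + l = n" "minor p q k l \<noteq> 0"
    and ij: "i \<in> T" "j \<in> T" "i + j = n" "minor p q i j \<noteq> 0"
  shows "(i, j) = (k, l) \<or> (i, j) = (l, k)"
proof -
  have main: "i \<le> max k l"
    if "k \<in> T" "l \<in> T" "k + l = n" "minor p q k l \<noteq> 0"
       "i \<in> T" "j \<in> T" "i + j = n" "minor p q i j \<noteq> 0" for i j k l
  proof (rule ccontr)
    assume "\<not> i \<le> max k l"
    hence "\<not> i + k \<le> n" "\<not> i + l \<le> n" using that by auto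
    hence "minor p q i k = 0" "minor p q i l = 0"
      using max that by blast+
    thus False using minor_proportional that by blast
  qed
  have swap: "minor p q l k \<noteq> 0" "minor p q j i \<noteq> 0"
    using kl ij minor_swap[of p q k l] minor_swap[of p q i j] by simp_all
  have "i \<le> max k l" "j \<le> max k l" "k \<le> max i j" "l \<le> max i j"
    using main[OF kl ij] main[of k l j i] main[OF ij kl] main[of i j l k] kl ij swap
    by simp_all
  thus ?thesis using kl(3) ij(3) by (auto simp: max_def split: if_splits)
qed

text \<open>
  Only the pair of largest weight contributes to the coefficient of \<open>r powi (k + l)\<close>, in its two
  orders and with minors of opposite signs. The pair is chosen before \<open>g\<close>, so that one pair can
  serve a whole family of functions \<open>g\<close>, such as one for each value of a real parameter.
\<close>

lemma extremal_pair:
  fixes p q :: "int \<Rightarrow> 'a :: field"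
  assumes fin: "finite T" and ex: "\<exists>k\<in>T. \<exists>l\<in>T. minor p q k l \<noteq> 0"
  obtains k l where "k \<in> T" "l \<in> T" "k \<noteq> l"
    and "\<forall>g A. infinite A \<and> 0 \<notin> A \<and>
           (\<forall>r\<in>A. (\<Sum>i\<in>T. \<Sum>j\<in>T. minor p q i j * g i j * r powi (i + j)) = 0) \<longrightarrow>
           g k l = g l k"
proof -
  define N where "N = {(i, j) \<in> T \<times> T. minor p q i j \<noteq> 0}"
  have finN: "finite N" by (rule finite_subset[of _ "T \<times> T"]) (auto simp: N_def fin)
  have neN: "N \<noteq> {}" using ex by (auto simp: N_def)
  define n where "n = Max ((\<lambda>(i, j). i + j) ` N)"
  have max: "i + j \<le> n" if "i \<in> T" "j \<in> T" "minor p q i j \<noteq> 0" for i j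
    unfolding n_def by (rule Max_ge) (use finN that in \<open>auto simp: N_def image_iff\<close>)
  have "n \<in> (\<lambda>(i, j). i + j) ` N"
    unfolding n_def by (rule Max_in) (use finN neN in auto)
  then obtain k l where kl: "k \<in> T" "l \<in> T" "k + l = n" "minor p q k l \<noteq> 0"
    by (auto simp: N_def)
  have "k \<noteq> l" using kl(4) by auto
  have "g k l = g l k"
    if "infinite A" "0 \<notin> A"
      and zero: "\<And>r. r \<in> A \<Longrightarrow> (\<Sum>i\<in>T. \<Sum>j\<in>T. minor p q i j * g i j * r powi (i + j)) = 0"
    for g A
  proof -
    define h where "h = (\<lambda>(i, j). minor p q i j * g i j)"
    define s where "s = (\<lambda>(i, j). i + j :: int)"
    have "(\<Sum>m\<in>s ` (T \<times> T). (\<Sum>x\<in>{x \<in> T \<times> T. s x = m}. h x) * r powi m) = 0" if "r \<in> A" for r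
    proof -
      have "(\<Sum>m\<in>s ` (T \<times> T). (\<Sum>x\<in>{x \<in> T \<times> T. s x = m}. h x) * r powi m)
          = (\<Sum>m\<in>s ` (T \<times> T). \<Sum>x\<in>{x \<in> T \<times> T. s x = m}. h x * r powi s x)"
        unfolding sum_distrib_right by (intro sum.cong refl) auto
      also have "\<dots> = (\<Sum>x\<in>T \<times> T. h x * r powi s x)"
        by (rule sum.group) (use fin in auto)
      also have "\<dots> = 0"
        using zero[OF that] by (simp add: sum.cartesian_product h_def s_def case_prod_beta)
      finally show ?thesis .
    qed
    hence "(\<Sum>x\<in>{x \<in> T \<times> T. s x = n}. h x) = 0"
      using laurent_coeff_eq_0[of "s ` (T \<times> T)" A "\<lambda>m. \<Sum>x\<in>{x \<in> T \<times> T. s x = m}. h x" n]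
        fin that(1,2) kl by (force simp: s_def)
    moreover have "(\<Sum>x\<in>{x \<in> T \<times> T. s x = n}. h x) = (\<Sum>x\<in>{(k, l), (l, k)}. h x)"
    proof (rule sum.mono_neutral_right)
      show "finite {x \<in> T \<times> T. s x = n}" using fin by simp
      show "{(k, l), (l, k)} \<subseteq> {x \<in> T \<times> T. s x = n}" using kl by (auto simp: s_def)
      show "\<forall>x\<in>{x \<in> T \<times> T. s x = n} - {(k, l), (l, k)}. h x = 0"
        using extremal_minor_unique[OF max kl] by (fastforce simp: s_def h_def)
    qed
    ultimately have "minor p q k l * (g k l - g l k) = 0"
      using \<open>k \<noteq> l\<close> minor_swap[of p q l k] by (auto simp: h_def algebra_simps)
    thus ?thesis using kl(4) by simp
  qed
  thus thesis using that kl \<open>k \<noteq> l\<close> by blast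
qed

text \<open>
  If all minors with nonzero indices vanished, then for any fixed \<open>m \<noteq> 0\<close> the combination of
  \<open>P - p 0\<close> and \<open>Q - q 0\<close> with the coefficients \<open>q m\<close> and \<open>- p m\<close> would be zero. Independence would then force
  \<open>p m = q m = 0\<close> for all these \<open>m\<close>, and \<open>P - p 0\<close> would itself be zero.
\<close>

lemma minor_nonzero_if_lin_indep:
  fixes P Q :: "real \<Rightarrow> real" and p q :: "int \<Rightarrow> real"
  assumes fin: "finite S" and supp: "\<And>k. k \<notin> S \<Longrightarrow> p k = 0 \<and> q k = 0"
    and P: "\<And>u. u \<in> I \<Longrightarrow> P u = (\<Sum>k\<in>S. p k * u powi k)"
    and Q: "\<And>u. u \<in> I \<Longrightarrow> Q u = (\<Sum>k\<in>S. q k * u powi k)"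
    and indep: "lin_indep_on I (\<lambda>u. P u - p 0) (\<lambda>u. Q u - q 0)"
  shows "\<exists>k\<in>S - {0}. \<exists>l\<in>S - {0}. minor p q k l \<noteq> 0"
proof (rule ccontr)
  assume "\<not> ?thesis"
  hence zero: "minor p q k l = 0" if "k \<in> S - {0}" "l \<in> S - {0}" for k l
    using that by blast
  have drop: "(\<Sum>k\<in>S. f k * u powi k) - f 0 = (\<Sum>k\<in>S - {0}. f k * u powi k)"
    if "\<And>k. k \<notin> S \<Longrightarrow> f k = 0" for u :: real and f
    using that fin by (cases "0 \<in> S") (simp_all add: sum.remove)
  have dep: "a = 0 \<and> b = 0" if ab: "\<And>k. k \<in> S - {0} \<Longrightarrow> a * p k + b * q k = 0" for a b
  proof -
    have "a * (P u - p 0) + b * (Q u - q 0) = 0" if u: "u \<in> I" for u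
    proof -
      have "a * (P u - p 0) + b * (Q u - q 0)
          = a * (\<Sum>k\<in>S - {0}. p k * u powi k) + b * (\<Sum>k\<in>S - {0}. q k * u powi k)"
        using drop[of p u] drop[of q u] supp P[OF u] Q[OF u] by simp
      also have "\<dots> = (\<Sum>k\<in>S - {0}. (a * p k + b * q k) * u powi k)"
        by (simp add: sum_distrib_left sum.distrib algebra_simps)
      finally show ?thesis using ab by simp
    qed
    thus ?thesis using indep unfolding lin_indep_on_def by blast
  qed
  have "q m = 0 \<and> - p m = 0" if "m \<in> S - {0}" for m
    using dep[of "q m" "- p m"] zero[OF _ that] by (simp add: minor_def algebra_simps)
  hence "(1 :: real) = 0" using dep[of 1 0] by simp
  thus False by simp
qed

section \<open>Derivations from a relation between two powers\<close>

text \<open>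
  For nonzero exponents the relation says that \<open>d (u powi k) / (k * u powi k)\<close> does not change when
  \<open>k\<close> is replaced by \<open>l\<close>. For a derivation this quotient is \<open>d u / u\<close> for every nonzero exponent.
\<close>

definition proportional_on_powers :: "(real \<Rightarrow> real) \<Rightarrow> int \<Rightarrow> int \<Rightarrow> bool" where
  "proportional_on_powers d k l \<longleftrightarrow>
     (\<forall>u>0. of_int l * u powi l * d (u powi k) = of_int k * u powi k * d (u powi l))"

text \<open>
  Polarization: compare \<open>d ((x + y)\<^sup>2)\<close> computed by additivity and by the rule for squares, which
  extends to negative arguments because both of its sides are even.
\<close>

lemma standard_derivation_if_squares:
  assumes "Modules.additive d" and sq: "\<And>u. u > 0 \<Longrightarrow> d (u\<^sup>2) = 2 * u * d u"
  shows "standard_derivation d"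
proof -
  interpret Modules.additive d by fact
  have sq': "d (u\<^sup>2) = 2 * u * d u" for u
    using sq[of u] sq[of "-u"] by (cases u "0 :: real" rule: linorder_cases) (auto simp: zero minus)
  have "d (x * y) = d x * y + x * d y" for x y
  proof -
    have "d ((x + y)\<^sup>2) = d (x\<^sup>2) + (d (x * y) + d (x * y)) + d (y\<^sup>2)"
      by (simp add: power2_eq_square algebra_simps flip: add)
    thus ?thesis by (simp add: sq' add algebra_simps)
  qed
  with assms(1) show ?thesis by (simp add: standard_derivation_def)
qed

text \<open>
  For positive exponents the relation at \<open>1 + r * u\<close> is a polynomial identity in \<open>r\<close>. Since \<open>d 1 = 0\<close>,
  the coefficients of \<open>r\<^sup>2\<close> on the two sides differ by
  \<open>k * l * (k - l) / 2\<close> times \<open>d (u\<^sup>2) - 2 * u * d u\<close>.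
\<close>

lemma squares_if_proportional_pos:
  fixes k l :: nat
  assumes d: "Modules.additive d" and d1: "d 1 = 0" and kl: "k > 0" "l > 0" "k \<noteq> l"
    and power_eq: "proportional_on_powers d (int k) (int l)" and "u > 0"
  shows "d (u\<^sup>2) = 2 * u * d u"
proof -
  \<comment> \<open>For \<open>f = d\<close> and for the identity, \<open>E f m\<close> is \<open>f ((1 + r * u) ^ m)\<close> as a polynomial in \<open>r\<close>.\<close>
  define E where "E = (\<lambda>f m. \<Sum>i\<le>m. monom (of_nat (m choose i) * f (u ^ i)) i :: real poly)"
  have coeff_E: "coeff (E f m) i = of_nat (m choose i) * f (u ^ i)" for f m i
    unfolding E_def by (simp add: coeff_sum)
  have poly_E: "poly (E f m) r = f ((1 + r * u) ^ m)"
    if f: "Modules.additive f" and r: "r \<in> \<rat>" for f :: "real \<Rightarrow> real" and m r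
  proof -
    have "f ((1 + r * u) ^ m) = f (\<Sum>i\<le>m. (of_nat (m choose i) * r ^ i) * u ^ i)"
      by (subst add.commute, subst binomial_ring) (simp add: power_mult_distrib mult_ac)
    also have "\<dots> = (\<Sum>i\<le>m. (of_nat (m choose i) * r ^ i) * f (u ^ i))"
      by (subst additive.sum[OF f], intro sum.cong refl additive_Rats_scale[OF f]) (use r in auto)
    finally show ?thesis by (simp add: E_def poly_sum poly_monom mult_ac)
  qed
  have id: "Modules.additive (\<lambda>x. x :: real)" by unfold_locales auto
  define F where "F = smult (of_nat l) (E (\<lambda>x. x) l * E d k) - smult (of_nat k) (E (\<lambda>x. x) k * E d l)"
  \<comment> \<open>Natural numbers are rational, infinite in number, and keep \<open>1 + r * u\<close> positive.\<close>
  have "poly F r = 0" if r: "r \<in> \<nat>" for r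
  proof -
    have "r \<in> \<rat>" "r \<ge> 0" using r by (auto elim: Nats_cases)
    moreover from this have "1 + r * u > 0" using \<open>u > 0\<close> by (simp add: add_pos_nonneg)
    ultimately show ?thesis
      using power_eq unfolding proportional_on_powers_def
      by (auto simp: F_def poly_E id d mult.assoc)
  qed
  hence "\<nat> \<subseteq> {r. poly F r = 0}" by auto
  moreover have "infinite (\<nat> :: real set)"
    by (simp add: Nats_def range_inj_infinite inj_of_nat)
  ultimately have "F = 0" using poly_roots_finite finite_subset by blast
  hence "coeff F 2 = 0" by simp
  hence "real l * (real (k choose 2) * d (u\<^sup>2) + real l * u * (real k * d u))
       = real k * (real (l choose 2) * d (u\<^sup>2) + real k * u * (real l * d u))"
    by (simp add: F_def coeff_mult numeral_2_eq_2 coeff_E d1)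
  moreover have "real (m choose 2) = real m * (real m - 1) / 2" for m
    by (induction m) (simp_all add: numeral_2_eq_2 field_simps)
  ultimately have "(real k * real l * (real k - real l)) * (d (u\<^sup>2) - 2 * u * d u) = 0"
    by (simp add: field_simps)
  thus ?thesis using kl by simp
qed

text \<open>
  Apply \<open>d\<close> to the partial fraction \<open>1 / u - 1 / (u + 1) = 1 / (u\<^sup>2 + u)\<close>.
\<close>

lemma squares_if_inverse:
  fixes d :: "real \<Rightarrow> real"
  assumes d: "Modules.additive d" and d1: "d 1 = 0"
    and inv: "\<And>v. v > 0 \<Longrightarrow> d (inverse v) = - d v / v\<^sup>2" and "u > 0"
  shows "d (u\<^sup>2) = 2 * u * d u"
proof -
  interpret Modules.additive d by fact
  have "inverse u - inverse (u + 1) = inverse (u\<^sup>2 + u)"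
  proof -
    have "u\<^sup>2 + u = u * (u + 1)" by algebra
    moreover have "inverse u - inverse (u + 1) = inverse (u * (u + 1))"
      using \<open>u > 0\<close> by (simp add: field_simps)
    ultimately show ?thesis by simp
  qed
  hence "d (inverse u) - d (inverse (u + 1)) = d (inverse (u\<^sup>2 + u))"
    by (metis diff)
  hence "- d u / u\<^sup>2 + d u / (u + 1)\<^sup>2 = - (d (u\<^sup>2) + d u) / (u\<^sup>2 + u)\<^sup>2"
    using \<open>u > 0\<close> by (simp add: inv add d1 add_pos_pos)
  moreover have "(u\<^sup>2 + u)\<^sup>2 = u\<^sup>2 * (u + 1)\<^sup>2" by algebra
  ultimately have "- d u * (u + 1)\<^sup>2 + d u * u\<^sup>2 = - (d (u\<^sup>2) + d u)"
    using \<open>u > 0\<close> by (simp add: divide_simps split: if_splits)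
  thus ?thesis by (simp add: power2_eq_square algebra_simps)
qed

text \<open>
  Using the relation at \<open>v powi k\<close> and at \<open>v powi l\<close> links the exponents \<open>k\<^sup>2\<close>, \<open>k * l\<close> and \<open>l\<^sup>2\<close>,
  so the pair \<open>(k\<^sup>2, l\<^sup>2)\<close> satisfies the relation too, and it falls under the positive case. Only
  \<open>k = - l\<close> makes the squares equal; there the relation is the rule for \<open>d (inverse v)\<close> at
  \<open>v = w powi l\<close>, and every positive \<open>v\<close> has this form.
\<close>

lemma squares_if_proportional:
  assumes d: "Modules.additive d" and d1: "d 1 = 0" and kl: "k \<noteq> 0" "l \<noteq> 0" "k \<noteq> l"
    and power_eq: "proportional_on_powers d k l" and "u > 0"
  shows "d (u\<^sup>2) = 2 * u * d u"
proof -
  have power_eq': "of_int l * v powi l * d (v powi k) = of_int k * v powi k * d (v powi l)"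
    if "v > 0" for v using power_eq that by (simp add: proportional_on_powers_def)
  show ?thesis
  proof (cases "k = - l")
    case False
    have "k\<^sup>2 \<noteq> l\<^sup>2" using kl False by (simp add: power2_eq_iff)
    hence ne: "nat (k\<^sup>2) \<noteq> nat (l\<^sup>2)" by (simp add: eq_nat_nat_iff)
    have "proportional_on_powers d (k\<^sup>2) (l\<^sup>2)"
      unfolding proportional_on_powers_def
    proof (intro allI impI)
      fix v :: real assume v: "v > 0"
      define X Y Z where "X = v powi k\<^sup>2" and "Y = v powi (k * l)" and "Z = v powi l\<^sup>2"
      have pos: "Y > 0" using v by (simp add: Y_def)
      have "of_int l * Y * d X = of_int k * X * d Y"
        using power_eq'[of "v powi k"] v
        by (simp add: X_def Y_def power2_eq_square flip: power_int_mult)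
      moreover have "of_int l * Z * d Y = of_int k * Y * d Z"
        using power_eq'[of "v powi l"] v
        by (simp add: Y_def Z_def power2_eq_square mult.commute[of l k] flip: power_int_mult)
      ultimately have "Y * ((of_int l)\<^sup>2 * Z * d X) = Y * ((of_int k)\<^sup>2 * X * d Z)"
        by algebra
      thus "of_int (l\<^sup>2) * v powi l\<^sup>2 * d (v powi k\<^sup>2) = of_int (k\<^sup>2) * v powi k\<^sup>2 * d (v powi l\<^sup>2)"
        using pos by (simp add: X_def Z_def)
    qed
    thus ?thesis
      using squares_if_proportional_pos[OF d d1 _ _ ne _ \<open>u > 0\<close>] kl by simp
  next
    case True
    have "d (inverse v) = - d v / v\<^sup>2" if v: "v > 0" for v
    proof -
      define w where "w = v powr (1 / of_int l)"
      have w: "w > 0" using v by (simp add: w_def)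
      have "w powi l = v"
        using v kl by (simp add: w_def powr_powr flip: powr_real_of_int')
      hence "of_int l * (v * d (inverse v)) = of_int l * (- inverse v * d v)"
        using power_eq'[OF w] by (simp add: True power_int_minus)
      hence "v * d (inverse v) = - inverse v * d v"
        using kl(2) by (metis mult_cancel_left of_int_eq_0_iff)
      thus ?thesis using v by (simp add: field_simps power2_eq_square)
    qed
    thus ?thesis by (rule squares_if_inverse[OF d d1 _ \<open>u > 0\<close>])
  qed
qed

section \<open>From the composite function to its two components\<close>

text \<open>
  By the mean value theorem \<open>Q\<close> is injective on the interval, so near \<open>u\<close> the function
  \<open>P\<close> is the composite of \<open>P \<circ> inv_into I Q\<close> with \<open>Q\<close>, and the chain rule applies.
\<close>

lemma derivates_chain:
  fixes d P Q P' Q' :: "real \<Rightarrow> real"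
  assumes "open I" "is_interval I"
    and P: "\<And>u. u \<in> I \<Longrightarrow> (P has_real_derivative P' u) (at u)"
    and Q: "\<And>u. u \<in> I \<Longrightarrow> (Q has_real_derivative Q' u) (at u)"
    and Q'_nz: "\<And>u. u \<in> I \<Longrightarrow> Q' u \<noteq> 0"
    and der: "derivates_on d (P \<circ> inv_into I Q) (Q ` I)" and u: "u \<in> I"
  shows "Q' u * d (P u) = P' u * d (Q u)"
proof -
  have ne: "Q x \<noteq> Q y" if xy: "x \<in> I" "y \<in> I" "x < y" for x y
  proof
    assume eq: "Q x = Q y"
    have sub: "{x..y} \<subseteq> I"
      using mem_is_interval_1_I[OF \<open>is_interval I\<close> xy(1,2)] by auto
    obtain z where z: "x < z" "z < y" "Q y - Q x = (y - x) * Q' z"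
      using MVT2[OF \<open>x < y\<close>, of Q Q'] Q sub by (meson atLeastAtMost_iff subsetD)
    moreover have "z \<in> I" using z sub by auto
    ultimately show False using eq Q'_nz by simp
  qed
  have inj: "inj_on Q I"
    by (rule inj_onI) (metis ne linorder_neqE)
  define f where "f = P \<circ> inv_into I Q"
  have fQ: "f (Q v) = P v" if "v \<in> I" for v
    using inj that by (simp add: f_def)
  define D where "D = deriv f (Q u)"
  have D: "(f has_real_derivative D) (at (Q u))"
    using der u unfolding derivates_on_def D_def f_def
    by (meson DERIV_deriv_iff_field_differentiable image_eqI)
  have "((\<lambda>v. f (Q v)) has_real_derivative D * Q' u) (at u)"
    using DERIV_chain2[OF D Q[OF u]] .
  hence "(P has_real_derivative D * Q' u) (at u)"
    by (rule has_field_derivative_transform_within_open[OF _ \<open>open I\<close> u]) (rule fQ)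
  hence "P' u = D * Q' u" using P[OF u] DERIV_unique by blast
  moreover have "d (P u) = D * d (Q u)"
    using der u fQ[OF u] unfolding derivates_on_def D_def f_def by (metis image_eqI)
  ultimately show ?thesis by simp
qed

section \<open>The theorem\<close>

theorem corollary9:
  fixes d P Q :: "real \<Rightarrow> real" and I :: "real set" and p q :: "int \<Rightarrow> real"
  assumes "Modules.additive d"
    and "open I" and "is_interval I" and "I \<noteq> {}" and "0 \<notin> I"
    and "\<forall>k. p k \<in> \<rat> \<and> q k \<in> \<rat>"
    and "finite {k. (p k, q k) \<noteq> (0, 0)}"
    and "\<forall>u\<in>I. P u = (\<Sum>k | (p k, q k) \<noteq> (0, 0). p k * u powi k)"
    and "\<forall>u\<in>I. Q u = (\<Sum>k | (p k, q k) \<noteq> (0, 0). q k * u powi k)"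
    and "\<forall>u\<in>I. deriv Q u \<noteq> 0"
    and "lin_indep_on I (\<lambda>u. P u - p 0) (\<lambda>u. Q u - q 0)"
    and "derivates_on d (P \<circ> inv_into I Q) (Q ` I)"
  shows "standard_derivation d"
proof -
  note d = assms(1)
  interpret Modules.additive d by (rule d)
  define S where "S = {k. (p k, q k) \<noteq> (0, 0)}"
  have fin: "finite S" using assms(7) by (simp add: S_def)
  have supp: "p k = 0 \<and> q k = 0" if "k \<notin> S" for k using that by (simp add: S_def)
  have P: "P u = (\<Sum>k\<in>S. p k * u powi k)" and Q: "Q u = (\<Sum>k\<in>S. q k * u powi k)"
    if "u \<in> I" for u using assms(8,9) that by (simp_all add: S_def)
  \<comment> \<open>The value of \<open>v * F'(v)\<close> for the Laurent polynomial \<open>F\<close> with coefficients \<open>f\<close>.\<close>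
  define wsum where "wsum = (\<lambda>f v. \<Sum>k\<in>S. of_int k * f k * v powi k :: real)"
  have deriv: "(F has_real_derivative wsum f v / v) (at v)"
    if "v \<in> I" and F: "\<And>u. u \<in> I \<Longrightarrow> F u = (\<Sum>k\<in>S. f k * u powi k)" for F f v
  proof (rule has_field_derivative_transform_within_open[OF _ \<open>open I\<close> \<open>v \<in> I\<close>])
    show "((\<lambda>u. \<Sum>k\<in>S. f k * u powi k) has_real_derivative wsum f v / v) (at v)"
      unfolding wsum_def by (rule DERIV_laurent) (use that assms(5) in auto)
  qed (simp add: F)
  have d_sum: "d (\<Sum>k\<in>S. f k * u powi k) = (\<Sum>k\<in>S. f k * d (u powi k))"
    if "\<And>k. f k \<in> \<rat>" for f u
    by (simp add: sum additive_Rats_scale[OF d that])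

  have rel: "(\<Sum>k\<in>S. \<Sum>l\<in>S. minor p q k l * (of_int l * v powi l * d (v powi k))) = 0"
    if v: "v \<in> I" for v
  proof -
    have "wsum q v / v * d (P v) = wsum p v / v * d (Q v)"
    proof (rule derivates_chain[OF assms(2,3) _ _ _ assms(12) v])
      fix u assume u: "u \<in> I"
      show "(P has_real_derivative wsum p u / u) (at u)" by (rule deriv[OF u P])
      show Q': "(Q has_real_derivative wsum q u / u) (at u)" by (rule deriv[OF u Q])
      show "wsum q u / u \<noteq> 0" using DERIV_imp_deriv[OF Q'] assms(10) u by metis
    qed
    moreover have "v \<noteq> 0" using v assms(5) by auto
    ultimately have "d (P v) * wsum q v - d (Q v) * wsum p v = 0" by (simp add: mult.commute)
    moreover have "d (P v) = (\<Sum>k\<in>S. p k * d (v powi k))" "d (Q v) = (\<Sum>k\<in>S. q k * d (v powi k))"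
      using d_sum assms(6) P[OF v] Q[OF v] by simp_all
    ultimately show ?thesis
      by (simp add: wsum_def sum_product minor_def algebra_simps sum_subtractf)
  qed
  have rel_scaled: "(\<Sum>k\<in>S. \<Sum>l\<in>S. minor p q k l * (of_int l * u powi l * d (u powi k)) * r powi (k + l)) = 0"
    if r: "r \<in> \<rat>" "r * u \<in> I" for r u
  proof -
    have r0: "r \<noteq> 0" using r assms(5) by auto
    have "r powi k \<in> \<rat>" for k using r(1) by (simp add: power_int_def)
    hence "d ((r * u) powi k) = r powi k * d (u powi k)" for k
      using additive_Rats_scale[OF d] by (simp add: power_int_mult_distrib)
    thus ?thesis
      using rel[OF r(2)] r0 by (simp add: power_int_mult_distrib power_int_add mult_ac)
  qed
  have nz: "\<exists>k\<in>S - {0}. \<exists>l\<in>S - {0}. minor p q k l \<noteq> 0"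
    by (rule minor_nonzero_if_lin_indep[OF fin supp P Q assms(11)])
  have inf: "infinite {r \<in> \<rat>. r * u \<in> I}" and zero_notin: "0 \<notin> {r \<in> \<rat>. r * u \<in> I}"
    if "u > 0" for u
    using infinite_rational_dilations[of I u] that assms(2,4,5) by auto

  \<comment> \<open>At \<open>u = 1\<close> every \<open>d (u powi k)\<close> is \<open>d 1\<close>; the extremal pair may contain the exponent zero here.\<close>
  have d1: "d 1 = 0"
  proof -
    have "\<exists>k\<in>S. \<exists>l\<in>S. minor p q k l \<noteq> 0" using nz by blast
    then obtain k l where "k \<in> S" "l \<in> S" "k \<noteq> l" and
      sym: "\<forall>g A. infinite A \<and> 0 \<notin> A \<and>
           (\<forall>r\<in>A. (\<Sum>i\<in>S. \<Sum>j\<in>S. minor p q i j * g i j * r powi (i + j)) = 0) \<longrightarrow>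
           g k l = g l k"
      using extremal_pair[OF fin] by blast
    have "of_int l * d 1 = of_int k * d 1"
      using sym[rule_format, of "{r \<in> \<rat>. r * 1 \<in> I}" "\<lambda>k l. of_int l * d 1"]
        inf[of 1] zero_notin[of 1] rel_scaled[of _ 1] by simp
    thus ?thesis using \<open>k \<noteq> l\<close> by simp
  qed

  \<comment> \<open>Leaving out the exponent zero does not change the sums, since \<open>d 1 = 0\<close>.\<close>
  obtain k l where kl: "k \<in> S - {0}" "l \<in> S - {0}" "k \<noteq> l" and
    sym: "\<forall>g A. infinite A \<and> 0 \<notin> A \<and>
           (\<forall>r\<in>A. (\<Sum>i\<in>S - {0}. \<Sum>j\<in>S - {0}. minor p q i j * g i j * r powi (i + j)) = 0) \<longrightarrow>
           g k l = g l k"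
    using extremal_pair[OF _ nz] fin by blast
  have "proportional_on_powers d k l"
    unfolding proportional_on_powers_def
  proof (intro allI impI)
    fix u :: real assume u: "u > 0"
    define g where "g = (\<lambda>k l. of_int l * u powi l * d (u powi k))"
    have "g k l = g l k"
    proof (intro sym[rule_format] conjI ballI, rule inf[OF u], rule zero_notin[OF u])
      fix r assume r: "r \<in> {r \<in> \<rat>. r * u \<in> I}"
      have g0: "g i j = 0" if "i = 0 \<or> j = 0" for i j using that d1 by (auto simp: g_def)
      have inner: "(\<Sum>j\<in>S - {0}. minor p q i j * g i j * r powi (i + j))
                 = (\<Sum>j\<in>S. minor p q i j * g i j * r powi (i + j))" for i
        by (rule sum.mono_neutral_left) (auto simp: fin g0)
      have "(\<Sum>i\<in>S - {0}. \<Sum>j\<in>S - {0}. minor p q i j * g i j * r powi (i + j))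
          = (\<Sum>i\<in>S. \<Sum>j\<in>S. minor p q i j * g i j * r powi (i + j))"
        unfolding inner by (rule sum.mono_neutral_left) (auto simp: fin g0)
      also have "\<dots> = 0" using rel_scaled r by (simp add: g_def)
      finally show "(\<Sum>i\<in>S - {0}. \<Sum>j\<in>S - {0}. minor p q i j * g i j * r powi (i + j)) = 0" .
    qed
    thus "of_int l * u powi l * d (u powi k) = of_int k * u powi k * d (u powi l)"
      by (simp add: g_def)
  qed
  thus ?thesis
    using standard_derivation_if_squares[OF d] squares_if_proportional[OF d d1 _ _ kl(3)] kl by simp
qed

end
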